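(* Let $p$ be a program, $H$ an architecture, $\alpha$ an abstraction mapping for $p$, $p_\bot$ the non-deterministic program corresponding to $p$ on the extended domain $\mathcal D\cup\{\bot\}$, and $p_\bot^\alpha$ its abstract version. If $p_\bot\approx_H p_\bot^\alpha$, then $$\mathrm{WCET}(p,H)\le\mathrm{WCET}(p_\bot^\alpha,H).$$
   Context: Programs and states. $\mathcal R$ is a finite set of registers containing a designated register $\mathbf{pc}$ (program counter; the status bits are regarded as part of $\mathbf{pc}$), $\mathcal M$ is a finite set of memory cell addresses (a subset of which forms the stack), $\mathcal D$ is a finite domain. A state is a map $v:\mathcal R\cup\mathcal M\to\mathcal D$; $\mathcal V$ is the set of states. A program $p$ is a finite list of instructions $i_1,i_2,\dots$ with initial instruction $i_1$. Each instruction $\iota$ (operands included) has a deterministic semantics $[\![\iota]\!]:\mathcal V\to\mathcal V$; a fixed duration in each stage of the processor pipeline, independent of operand contents; a set $\mathrm{regR}(\iota)$ of registers it reads and a set $\mathrm{regW}(\iota)$ of registers it writes; and sets $\mathrm{memR}(\iota),\mathrm{memW}(\iota)$ of memory cell addresses it reads from and writes to when executed; if $\iota$ references memory cells, the referenced addresses are computed from the values, in the state in which $\iota$ is executed, of the registers in $\mathrm{regR}(\iota)\cup\mathrm{regW}(\iota)$. In state $v$ the instruction executed is the one pointed to by $v(\mathbf{pc})$; $\mathbf{pc}$ is incremented by $1$ after each instruction, except for branching instructions. Runs. The run of $p$ from $v_0$ is the unique sequence $\rho(p,v_0)=\iota_1\cdots\iota_n$ of instructions performed by $p$ from $v_0$,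 with $\iota_1=i_1$ and states $v_{j+1}=[\![\iota_{j+1}]\!](v_j)$. Every run terminates, and there is a constant $K_p$ bounding the length of all runs of $p$. Execution time. An architecture $H$ consists of the pipeline structure, caches (initial state, size, replacement policy), main memory, and their timing specifications. Two runs (sequences of executed instructions) $\rho=\iota_1\cdots\iota_n$ and $\rho'=\iota_1'\cdots\iota_n'$ are $H$-equivalent, $\rho\approx_H\rho'$, if for each $1\le k\le n$: $\iota_k$ and $\iota_k'$ have the same duration in each pipeline stage, and $\phi(\iota_k)=\phi(\iota'_k)$ for $\phi\in\{\mathrm{regR},\mathrm{regW},\mathrm{memR},\mathrm{memW}\}$ (for $\mathrm{memR},\mathrm{memW}$: the addresses actually referenced at step $k$). The execution time $\mathrm{time}_H(\rho)$ is completely determined by $H$ and by these data, so $\rho\approx_H\rho'$ implies $\mathrm{time}_H(\rho)=\mathrm{time}_H(\rho')$. Let $\mathcal V_0\subseteq\mathcal V$ be the (finite, nonempty) set of initial states given by the possible input data; then $\mathrm{WCET}(p,H)=\max_{v_0\in\mathcal V_0}\mathrm{time}_H(\rho(p,v_0))$. Critical instructions. An instruction is critical if (i) it sets some status bits, or (ii) it references a memory cell. Extended domain and $p_\bot$. Extended states are maps $v:\mathcal R\cup\mathcal M\to\mathcal D\cup\{\bot\}$, where $\bot$ means "unknown". The initial extended state $v_0$ has $v_0(x)=\bot$ for all $x\in(\mathcal R\setminus\{\mathbf{pc}\})\cup\mathcal M$ and $v_0(\mathbf{pc})$ the address of the first instruction of $p$. It is assumed that the addresses of memory cells referenced during execution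 depend only on the current state through known register values and are independent of the input data values. The semantics of instructions is extended as follows: an arithmetic or logical instruction gives result $\bot$ if one of its operands is $\bot$; an instruction that sets status bits and has an operand equal to $\bot$ has several next states, one for each possible value of the status bits; a memory transfer (load, store) puts $\bot$ in the target memory cell or register, except that transfers involving the stack keep track of the values pushed and popped; a branching instruction has one next state, determined by its target (unconditional) or by the status bits (conditional). The resulting non-deterministic program is $p_\bot$. Its semantics from the initial extended state is a tree $\mathrm{tree}(p_\bot)$, branching according to the choices of status bits, truncated at depth at most $K_p$. $\mathrm{Runs}(p_\bot)$ is the set of rooted paths of $\mathrm{tree}(p_\bot)$. Under these assumptions $p_\bot$ simulates $p$: for every run $\rho(p,v_0)$ of $p$ on input data $v_0$ there is $\rho'\in\mathrm{Runs}(p_\bot)$ with $\rho(p,v_0)\approx_H\rho'$. Abstraction. For an instruction $\iota$, the abstracted instruction $\iota^a$ has semantics (on states and on extended states) $[\![\iota^a]\!](v)=v'$ with $v'(x)=v(x)$ for every register $x\ne\mathbf{pc}$ and every $x\in\mathcal M$, and $v'(\mathbf{pc})=v(\mathbf{pc})+1$; it has the same duration as $\iota$ in each pipeline stage, and $\phi(\iota^a)=\phi(\iota)$ for $\phi\in\{\mathrm{regR},\mathrm{regW},\mathrm{memR},\mathrm{memW}\}$ (with addresses computed from operand registers in the same way). An abstraction mapping $\alpha$ assigns to each instruction $\iota$ of $p$ either $\iota$ or $\iota^a$; write $\iota^\alpha=\alpha(\iota)$. $p_\bot^\alpha$ is obtained from $p_\bot$ by replacing each instruction $\iota$ by $\iota^\alpha$.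 To each run $\rho=\iota_1\cdots\iota_k\in\mathrm{Runs}(p_\bot)$ with extended states $v_0,v_1,\dots,v_k$ corresponds the $\alpha$-abstracted run $\rho^\alpha=\iota_1^\alpha\cdots\iota_k^\alpha$ of $p_\bot^\alpha$, with states $v_0^\alpha=v_0$ and $v_{j+1}^\alpha$ obtained from $v_j^\alpha$ by executing $\iota_{j+1}^\alpha$ (with the same choices of undetermined status bits as in $\rho$). $\mathrm{Runs}(p_\bot^\alpha)$ is the set of these runs $\rho^\alpha$, and $\mathrm{WCET}(p_\bot^\alpha,H)=\max_{\rho'\in\mathrm{Runs}(p_\bot^\alpha)}\mathrm{time}_H(\rho')$. Equivalence. $p_\bot\approx_H p_\bot^\alpha$ means: for every $\rho=\iota_1\cdots\iota_k\in\mathrm{Runs}(p_\bot)$ and every $j$ such that $\iota_{j+1}$ is critical, $v_j(r)=v_j^\alpha(r)$ for all $r\in\mathrm{regR}(\iota_{j+1})\cup\mathrm{regW}(\iota_{j+1})$. *)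

theory Defs
  imports Complex_Main
begin

text \<open>
  Registers, memory cell addresses and the domain are the finite types \<open>'r\<close>, \<open>'m\<close>, \<open>'d\<close>;
  \<open>'s\<close> is the type of values of the status bits and \<open>'g\<close> the type of pipeline stages.
  In an extended state, \<open>None\<close> is the unknown value \<open>\<bottom>\<close>.
\<close>

type_synonym ('r, 'm, 'd) state = "'r + 'm \<Rightarrow> 'd"
type_synonym ('r, 'm, 'd) estate = "'r + 'm \<Rightarrow> 'd option"
type_synonym ('r, 'd) regval = "'r \<Rightarrow> 'd option"

definition lift :: "('r, 'm, 'd) state \<Rightarrow> ('r, 'm, 'd) estate" where
  "lift w = (\<lambda>x. Some (w x))"

definition regs :: "('r, 'm, 'd) estate \<Rightarrow> ('r, 'd) regval" where
  "regs v = (\<lambda>r. v (Inl r))"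

text \<open>
  Since the status bits are part of \<open>pc\<close>, a content \<open>d\<close> of \<open>pc\<close> encodes both a position
  \<open>addr d\<close> in the program (positions count from 0) and a value \<open>status d\<close> of the status bits.
  \<open>entry\<close> is the content of \<open>pc\<close> at the start of the program.
\<close>

record ('r, 'm, 'd, 's) machine =
  pc :: 'r
  stack :: "'m set"
  addr :: "'d \<Rightarrow> nat"
  status :: "'d \<Rightarrow> 's"
  set_status :: "'s \<Rightarrow> 'd \<Rightarrow> 'd"
  entry :: 'd

text \<open>\<open>Skip\<close> is the kind of the abstracted instructions only.\<close>

datatype kind = Arith | Transfer | Branch | Skip

text \<open>
  \<open>memR\<close>, \<open>memW\<close> give the addresses referenced under given (possibly unknown) register contents.
  \<open>src \<iota> u x\<close> is used for transfers and branches: the locations from which \<open>\<iota>\<close> obtains the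
  new content of \<open>x\<close>.  It is needed per location: \<open>push r\<close> moves \<open>r\<close> into a stack cell but
  computes the new stack pointer from the old one only, and \<open>pop\<close> of several
  registers takes each of them from its own cell.
\<close>

record ('g, 'r, 'm, 'd) instr =
  kind :: kind
  sem :: "('r, 'm, 'd) state \<Rightarrow> ('r, 'm, 'd) state"
  dur :: "'g \<Rightarrow> real"
  regR :: "'r set"
  regW :: "'r set"
  memR :: "('r, 'd) regval \<Rightarrow> 'm set"
  memW :: "('r, 'd) regval \<Rightarrow> 'm set"
  sets_status :: bool
  src :: "('r, 'd) regval \<Rightarrow> 'r + 'm \<Rightarrow> ('r + 'm) set"

type_synonym ('g, 'r, 'm, 'd) program = "('g, 'r, 'm, 'd) instr list"

definition operands :: "('g, 'r, 'm, 'd) instr \<Rightarrow> ('r, 'd) regval \<Rightarrow> ('r + 'm) set" where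
  "operands \<iota> u = Inl ` regR \<iota> \<union> Inr ` memR \<iota> u"

definition targets :: "('g, 'r, 'm, 'd) instr \<Rightarrow> ('r, 'd) regval \<Rightarrow> ('r + 'm) set" where
  "targets \<iota> u = Inl ` regW \<iota> \<union> Inr ` memW \<iota> u"

definition inputs ::
  "('g, 'r, 'm, 'd) instr \<Rightarrow> ('r, 'd) regval \<Rightarrow> 'r + 'm \<Rightarrow> ('r + 'm) set" where
  "inputs \<iota> u x = (if kind \<iota> = Arith then operands \<iota> u else src \<iota> u x)"

definition same_access ::
  "('g, 'r, 'm, 'd) instr \<Rightarrow> ('r, 'd) regval \<Rightarrow> ('r, 'd) regval \<Rightarrow> bool" where
  "same_access \<iota> u u' \<longleftrightarrow> memR \<iota> u = memR \<iota> u' \<and> memW \<iota> u = memW \<iota> u' \<and> src \<iota> u = src \<iota> u'"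

definition references_memory :: "('g, 'r, 'm, 'd) instr \<Rightarrow> bool" where
  "references_memory \<iota> \<longleftrightarrow> (\<exists>u. memR \<iota> u \<noteq> {} \<or> memW \<iota> u \<noteq> {})"

definition critical :: "('g, 'r, 'm, 'd) instr \<Rightarrow> bool" where
  "critical \<iota> \<longleftrightarrow> sets_status \<iota> \<or> references_memory \<iota>"

text \<open>
  The increment of \<open>pc\<close> is addition of 1 in the (finite) domain; it moves to the next
  position and leaves the status bits alone as long as \<open>pc\<close> points into the program.
\<close>

definition valid_machine ::
  "('r, 'm, 'd::{plus,one}, 's) machine \<Rightarrow> ('g, 'r, 'm, 'd) program \<Rightarrow> bool" where
  "valid_machine M p \<longleftrightarrow>
     addr M (entry M) = 0 \<and>
     (\<forall>d. addr M d < length p \<longrightarrow>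
        addr M (d + 1) = Suc (addr M d) \<and> status M (d + 1) = status M d) \<and>
     (\<forall>s d. addr M (set_status M s d) = addr M d \<and> status M (set_status M s d) = s) \<and>
     (\<forall>d. set_status M (status M d) d = d)"

text \<open>
  Effect of an instruction on \<open>pc\<close>.  The new content of \<open>pc\<close> may always depend on the old one
  (relative targets, conditions on the status bits, instructions setting only some of them).
\<close>

definition valid_pc ::
  "('r, 'm, 'd::{plus,one}, 's) machine \<Rightarrow> ('g, 'r, 'm, 'd) instr \<Rightarrow> bool" where
  "valid_pc M \<iota> \<longleftrightarrow>
     (let P = Inl (pc M) in
      if kind \<iota> = Branch
      then \<not> sets_status \<iota> \<and>
           (\<forall>w w'. same_access \<iota> (regs (lift w)) (regs (lift w')) \<and>
              (\<forall>y\<in>insert P (src \<iota> (regs (lift w)) P). w y = w' y) \<longrightarrow> sem \<iota> w P = sem \<iota> w' P)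
      else if sets_status \<iota>
      then (\<forall>w. \<exists>s. sem \<iota> w P = set_status M s (w P + 1)) \<and>
           (\<forall>w w'. same_access \<iota> (regs (lift w)) (regs (lift w')) \<and>
              (\<forall>y\<in>insert P (operands \<iota> (regs (lift w))). w y = w' y) \<longrightarrow> sem \<iota> w P = sem \<iota> w' P)
      else (\<forall>w. sem \<iota> w P = w P + 1))"

text \<open>
  The fields of an instruction describe its semantics: addresses are computed from the registers
  read or written; only \<open>pc\<close> and the declared targets change; and the new content of a
  target is a function of the locations declared as its inputs.
\<close>

definition valid_instr ::
  "('r, 'm, 'd::{plus,one}, 's) machine \<Rightarrow> ('g, 'r, 'm, 'd) instr \<Rightarrow> bool" where
  "valid_instr M \<iota> \<longleftrightarrow>
     kind \<iota> \<noteq> Skip \<and>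
     (\<forall>u u'. (\<forall>r\<in>regR \<iota> \<union> regW \<iota>. u r = u' r) \<longrightarrow> same_access \<iota> u u') \<and>
     (\<forall>u x. src \<iota> u x \<subseteq> insert (Inl (pc M)) (operands \<iota> u)) \<and>
     (\<forall>w x. x \<notin> insert (Inl (pc M)) (targets \<iota> (regs (lift w))) \<longrightarrow> sem \<iota> w x = w x) \<and>
     (\<forall>w w'. same_access \<iota> (regs (lift w)) (regs (lift w')) \<longrightarrow>
        (\<forall>x \<in> targets \<iota> (regs (lift w)) - {Inl (pc M)}.
           (\<forall>y\<in>inputs \<iota> (regs (lift w)) x. w y = w' y) \<longrightarrow> sem \<iota> w x = sem \<iota> w' x)) \<and>
     valid_pc M \<iota>"

definition valid_program ::
  "('r, 'm, 'd::{plus,one}, 's) machine \<Rightarrow> ('g, 'r, 'm, 'd) program \<Rightarrow> bool" where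
  "valid_program M p \<longleftrightarrow> p \<noteq> [] \<and> valid_machine M p \<and> (\<forall>\<iota>\<in>set p. valid_instr M \<iota>)"

subsection \<open>Execution time\<close>

text \<open>
  A run is the sequence of executed instructions, each together with the state in which it is
  executed (which determines the addresses actually referenced).
\<close>

type_synonym ('g, 'r, 'm, 'd) run = "(('g, 'r, 'm, 'd) instr \<times> ('r, 'm, 'd) estate) list"

record ('g, 'r, 'm) timing =
  tdur :: "'g \<Rightarrow> real"
  tregR :: "'r set"
  tregW :: "'r set"
  tmemR :: "'m set"
  tmemW :: "'m set"

text \<open>
  An architecture enters only through the execution time it assigns to the sequence of the
  timing data of a run.
\<close>

type_synonym ('g, 'r, 'm) architecture = "('g, 'r, 'm) timing list \<Rightarrow> real"

fun timing_of :: "('g, 'r, 'm, 'd) instr \<times> ('r, 'm, 'd) estate \<Rightarrow> ('g, 'r, 'm) timing" where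
  "timing_of (\<iota>, v) =
     \<lparr>tdur = dur \<iota>, tregR = regR \<iota>, tregW = regW \<iota>,
      tmemR = memR \<iota> (regs v), tmemW = memW \<iota> (regs v)\<rparr>"

definition time :: "('g, 'r, 'm) architecture \<Rightarrow> ('g, 'r, 'm, 'd) run \<Rightarrow> real" where
  "time H \<rho> = H (map timing_of \<rho>)"

definition h_equiv :: "('g, 'r, 'm, 'd) run \<Rightarrow> ('g, 'r, 'm, 'd) run \<Rightarrow> bool" where
  "h_equiv \<rho> \<rho>' \<longleftrightarrow> length \<rho> = length \<rho>' \<and>
     (\<forall>k<length \<rho>. case (\<rho> ! k, \<rho>' ! k) of ((\<iota>, v), (\<iota>', v')) \<Rightarrow>
        dur \<iota> = dur \<iota>' \<and> regR \<iota> = regR \<iota>' \<and> regW \<iota> = regW \<iota>' \<and>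
        memR \<iota> (regs v) = memR \<iota>' (regs v') \<and> memW \<iota> (regs v) = memW \<iota>' (regs v'))"

lemma h_equiv_time: "h_equiv \<rho> \<rho>' \<Longrightarrow> time H \<rho> = time H \<rho>'"
proof -
  assume eq: "h_equiv \<rho> \<rho>'"
  have "timing_of (\<rho> ! k) = timing_of (\<rho>' ! k)" if "k < length \<rho>" for k
    using eq that by (cases "\<rho> ! k"; cases "\<rho>' ! k") (auto simp: h_equiv_def)
  then have "map timing_of \<rho> = map timing_of \<rho>'"
    using eq by (intro nth_equalityI) (auto simp: h_equiv_def)
  then show ?thesis by (simp add: time_def)
qed

subsection \<open>Runs of the program\<close>

definition points_into ::
  "('r, 'm, 'd, 's) machine \<Rightarrow> ('g, 'r, 'm, 'd) program \<Rightarrow> ('r, 'm, 'd) estate \<Rightarrow> bool" where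
  "points_into M p v \<longleftrightarrow> (\<exists>d. v (Inl (pc M)) = Some d \<and> addr M d < length p)"

definition pos :: "('r, 'm, 'd, 's) machine \<Rightarrow> ('r, 'm, 'd) estate \<Rightarrow> nat" where
  "pos M v = addr M (the (v (Inl (pc M))))"

primrec state_at ::
  "('r, 'm, 'd, 's) machine \<Rightarrow> ('g, 'r, 'm, 'd) program \<Rightarrow> ('r, 'm, 'd) state \<Rightarrow> nat
     \<Rightarrow> ('r, 'm, 'd) state" where
  "state_at M p w 0 = w"
| "state_at M p w (Suc j) = sem (p ! pos M (lift (state_at M p w j))) (state_at M p w j)"

text \<open>A run ends as soon as \<open>pc\<close> does not point to an instruction of the program.\<close>

definition terminates_within ::
  "('r, 'm, 'd, 's) machine \<Rightarrow> ('g, 'r, 'm, 'd) program \<Rightarrow> nat \<Rightarrow> ('r, 'm, 'd) state \<Rightarrow> bool" where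
  "terminates_within M p K w \<longleftrightarrow> (\<exists>n\<le>K. \<not> points_into M p (lift (state_at M p w n)))"

definition run_length ::
  "('r, 'm, 'd, 's) machine \<Rightarrow> ('g, 'r, 'm, 'd) program \<Rightarrow> ('r, 'm, 'd) state \<Rightarrow> nat" where
  "run_length M p w = (LEAST n. \<not> points_into M p (lift (state_at M p w n)))"

definition run ::
  "('r, 'm, 'd, 's) machine \<Rightarrow> ('g, 'r, 'm, 'd) program \<Rightarrow> ('r, 'm, 'd) state
     \<Rightarrow> ('g, 'r, 'm, 'd) run" where
  "run M p w =
     map (\<lambda>j. (p ! pos M (lift (state_at M p w j)), lift (state_at M p w j)))
       [0..<run_length M p w]"

definition WCET ::
  "('r, 'm, 'd, 's) machine \<Rightarrow> ('g, 'r, 'm) architecture \<Rightarrow> ('g, 'r, 'm, 'd) program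
     \<Rightarrow> ('r, 'm, 'd) state set \<Rightarrow> real" where
  "WCET M H p V0 = Max ((\<lambda>w. time H (run M p w)) ` V0)"

subsection \<open>The program on the extended domain\<close>

text \<open>The content of unknown locations is irrelevant wherever \<open>conc\<close> is used below.\<close>

definition conc :: "('r, 'm, 'd) estate \<Rightarrow> ('r, 'm, 'd) state" where
  "conc v = (\<lambda>x. case v x of None \<Rightarrow> undefined | Some d \<Rightarrow> d)"

text \<open>A transfer from or to a memory cell outside the stack.\<close>

definition off_stack ::
  "('r, 'm, 'd, 's) machine \<Rightarrow> ('g, 'r, 'm, 'd) instr \<Rightarrow> ('r, 'd) regval \<Rightarrow> 'r + 'm \<Rightarrow> bool" where
  "off_stack M \<iota> u x \<longleftrightarrow> kind \<iota> \<noteq> Arith \<and> (\<exists>a. a \<notin> stack M \<and> Inr a \<in> insert x (src \<iota> u x))"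

definition result ::
  "('r, 'm, 'd, 's) machine \<Rightarrow> ('g, 'r, 'm, 'd) instr \<Rightarrow> ('r, 'm, 'd) estate \<Rightarrow> 'r + 'm
     \<Rightarrow> 'd option" where
  "result M \<iota> v x =
     (if off_stack M \<iota> (regs v) x \<or> (\<exists>y\<in>inputs \<iota> (regs v) x. v y = None)
      then None else Some (sem \<iota> (conc v) x))"

text \<open>
  The extended semantics of an instruction for a given choice \<open>s\<close> of the status bits.  The choice
  matters only where the status bits are undetermined.
\<close>

definition ext_exec ::
  "('r, 'm, 'd::{plus,one}, 's) machine \<Rightarrow> ('g, 'r, 'm, 'd) instr \<Rightarrow> 's
     \<Rightarrow> ('r, 'm, 'd) estate \<Rightarrow> ('r, 'm, 'd) estate" where
  "ext_exec M \<iota> s v = (\<lambda>x.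
     let next_pc = map_option (\<lambda>d. d + 1) (v (Inl (pc M))) in
     if x = Inl (pc M) then
       (if kind \<iota> = Branch then result M \<iota> v x
        else if kind \<iota> = Skip \<or> \<not> sets_status \<iota> then next_pc
        else if \<exists>y\<in>operands \<iota> (regs v). v y = None then map_option (set_status M s) next_pc
        else Some (sem \<iota> (conc v) x))
     else if kind \<iota> = Skip \<or> x \<notin> targets \<iota> (regs v) then v x
     else result M \<iota> v x)"

definition ext_sem ::
  "('r, 'm, 'd::{plus,one}, 's) machine \<Rightarrow> ('g, 'r, 'm, 'd) instr
     \<Rightarrow> ('r, 'm, 'd) estate \<Rightarrow> ('r, 'm, 'd) estate set" where
  "ext_sem M \<iota> v = range (\<lambda>s. ext_exec M \<iota> s v)"

definition init_estate :: "('r, 'm, 'd, 's) machine \<Rightarrow> ('r, 'm, 'd) estate" where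
  "init_estate M = (\<lambda>x. if x = Inl (pc M) then Some (entry M) else None)"

text \<open>
  The rooted paths, of length at most \<open>K\<close>, of the tree of the extended program.  A path is
  given by its states \<open>v\<^sub>0, \<dots>, v\<^sub>k\<close>; its edge from \<open>v\<^sub>j\<close> is labelled by the instruction
  at position \<open>pos M v\<^sub>j\<close>.  Different choices of the status bits lead to different states.
\<close>

definition bot_paths ::
  "('r, 'm, 'd::{plus,one}, 's) machine \<Rightarrow> ('g, 'r, 'm, 'd) program \<Rightarrow> nat
     \<Rightarrow> ('r, 'm, 'd) estate list set" where
  "bot_paths M p K =
     {vs. vs \<noteq> [] \<and> length vs \<le> Suc K \<and> vs ! 0 = init_estate M \<and>
        (\<forall>j. Suc j < length vs \<longrightarrow>
           points_into M p (vs ! j) \<and> vs ! Suc j \<in> ext_sem M (p ! pos M (vs ! j)) (vs ! j))}"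

text \<open>
  The addresses referenced during execution (and the role of each of them in a transfer) are
  determined by the known registers: they are the same however unknown registers are filled in.
\<close>

definition addresses_known ::
  "('r, 'm, 'd::{plus,one}, 's) machine \<Rightarrow> ('g, 'r, 'm, 'd) program \<Rightarrow> nat \<Rightarrow> bool" where
  "addresses_known M p K \<longleftrightarrow>
     (\<forall>vs\<in>bot_paths M p K. \<forall>j. Suc j < length vs \<longrightarrow>
        (\<forall>u. (\<forall>r. regs (vs ! j) r \<noteq> None \<longrightarrow> u r = regs (vs ! j) r) \<longrightarrow>
           same_access (p ! pos M (vs ! j)) (regs (vs ! j)) u))"

text \<open>
  The target of an executed branching instruction is known; trivially so if branching depends only
  on constants and \<open>pc\<close>.
\<close>

definition branches_known ::
  "('r, 'm, 'd::{plus,one}, 's) machine \<Rightarrow> ('g, 'r, 'm, 'd) program \<Rightarrow> nat \<Rightarrow> bool" where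
  "branches_known M p K \<longleftrightarrow>
     (\<forall>vs\<in>bot_paths M p K. \<forall>j. Suc j < length vs \<longrightarrow>
        kind (p ! pos M (vs ! j)) = Branch \<longrightarrow> (vs ! Suc j) (Inl (pc M)) \<noteq> None)"

subsection \<open>Abstraction\<close>

definition abstracted ::
  "('r, 'm, 'd::{plus,one}, 's) machine \<Rightarrow> ('g, 'r, 'm, 'd) instr \<Rightarrow> ('g, 'r, 'm, 'd) instr" where
  "abstracted M \<iota> =
     \<iota>\<lparr>kind := Skip, sets_status := False, sem := (\<lambda>w. w(Inl (pc M) := w (Inl (pc M)) + 1))\<rparr>"

text \<open>
  Abstraction mappings act on positions, so that two occurrences of the same instruction can be
  treated differently.
\<close>

definition abstraction_mapping ::
  "('r, 'm, 'd::{plus,one}, 's) machine \<Rightarrow> ('g, 'r, 'm, 'd) program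
     \<Rightarrow> (nat \<Rightarrow> ('g, 'r, 'm, 'd) instr) \<Rightarrow> bool" where
  "abstraction_mapping M p \<alpha> \<longleftrightarrow> (\<forall>i<length p. \<alpha> i = p ! i \<or> \<alpha> i = abstracted M (p ! i))"

text \<open>
  The states of the abstracted run.  Its instructions are those of the original run, and
  undetermined status bits are taken from the original run.
\<close>

primrec abs_state ::
  "('r, 'm, 'd::{plus,one}, 's) machine \<Rightarrow> (nat \<Rightarrow> ('g, 'r, 'm, 'd) instr)
     \<Rightarrow> ('r, 'm, 'd) estate list \<Rightarrow> nat \<Rightarrow> ('r, 'm, 'd) estate" where
  "abs_state M \<alpha> vs 0 = vs ! 0"
| "abs_state M \<alpha> vs (Suc j) =
     ext_exec M (\<alpha> (pos M (vs ! j))) (status M (the ((vs ! Suc j) (Inl (pc M)))))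
       (abs_state M \<alpha> vs j)"

definition abs_run ::
  "('r, 'm, 'd::{plus,one}, 's) machine \<Rightarrow> (nat \<Rightarrow> ('g, 'r, 'm, 'd) instr)
     \<Rightarrow> ('r, 'm, 'd) estate list \<Rightarrow> ('g, 'r, 'm, 'd) run" where
  "abs_run M \<alpha> vs = map (\<lambda>j. (\<alpha> (pos M (vs ! j)), abs_state M \<alpha> vs j)) [0..<length vs - 1]"

definition abs_runs ::
  "('r, 'm, 'd::{plus,one}, 's) machine \<Rightarrow> ('g, 'r, 'm, 'd) program \<Rightarrow> nat
     \<Rightarrow> (nat \<Rightarrow> ('g, 'r, 'm, 'd) instr) \<Rightarrow> ('g, 'r, 'm, 'd) run set" where
  "abs_runs M p K \<alpha> = abs_run M \<alpha> ` bot_paths M p K"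

definition abs_WCET ::
  "('r, 'm, 'd::{plus,one}, 's) machine \<Rightarrow> ('g, 'r, 'm) architecture
     \<Rightarrow> ('g, 'r, 'm, 'd) program \<Rightarrow> nat \<Rightarrow> (nat \<Rightarrow> ('g, 'r, 'm, 'd) instr) \<Rightarrow> real" where
  "abs_WCET M H p K \<alpha> = Max (time H ` abs_runs M p K \<alpha>)"

definition abs_equiv ::
  "('r, 'm, 'd::{plus,one}, 's) machine \<Rightarrow> ('g, 'r, 'm, 'd) program \<Rightarrow> nat
     \<Rightarrow> (nat \<Rightarrow> ('g, 'r, 'm, 'd) instr) \<Rightarrow> bool" where
  "abs_equiv M p K \<alpha> \<longleftrightarrow>
     (\<forall>vs\<in>bot_paths M p K. \<forall>j. Suc j < length vs \<longrightarrow>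
        (let \<iota> = p ! pos M (vs ! j) in critical \<iota> \<longrightarrow>
           (\<forall>r\<in>regR \<iota> \<union> regW \<iota>. (vs ! j) (Inl r) = abs_state M \<alpha> vs j (Inl r))))"

end

theory Submission
  imports Defs
begin

text \<open>
  A concrete run is followed in the tree of the extended program by choosing, at every step, the
  status bits that the concrete run produces.  The extended states of this path agree with the
  concrete ones on all known locations, so the same instructions are executed and the same
  addresses are referenced.  Addresses are computed from the registers read or written, on which
  the path and its abstracted run agree at critical instructions; other instructions reference no
  memory.  Hence the abstracted run has the timing data of the concrete run.
\<close>

section \<open>Soundness of a single extended step\<close>

definition approximates :: "('r, 'm, 'd) estate \<Rightarrow> ('r, 'm, 'd) state \<Rightarrow> bool" where
  "approximates v w \<longleftrightarrow> (\<forall>x. v x \<noteq> None \<longrightarrow> v x = Some (w x))"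

lemma approximates_SomeD: "approximates v w \<Longrightarrow> v x = Some d \<Longrightarrow> d = w x"
  unfolding approximates_def by fastforce

lemma approximates_conc: "approximates v (conc v)"
  unfolding approximates_def conc_def by auto

lemma approximates_agree:
  "approximates v w \<Longrightarrow> approximates v w' \<Longrightarrow> v x \<noteq> None \<Longrightarrow> w x = w' x"
  unfolding approximates_def by (metis option.inject)

text \<open>The condition of \<open>addresses_known\<close> at a single state, separated from paths
  so that one step can be treated on its own.\<close>

definition access_known :: "('g, 'r, 'm, 'd) instr \<Rightarrow> ('r, 'm, 'd) estate \<Rightarrow> bool" where
  "access_known \<iota> v \<longleftrightarrow>
     (\<forall>u. (\<forall>r. regs v r \<noteq> None \<longrightarrow> u r = regs v r) \<longrightarrow> same_access \<iota> (regs v) u)"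

lemma access_known_lift:
  assumes "access_known \<iota> v" "approximates v w"
  shows "same_access \<iota> (regs v) (regs (lift w))"
  using assms unfolding access_known_def approximates_def regs_def lift_def by fastforce

text \<open>A known result is computed by \<open>sem\<close> on the filling \<open>conc v\<close>.
  All its inputs are then known, so \<open>conc v\<close> and \<open>w\<close> agree on them, and
  the dependence clauses of \<open>valid_instr\<close> and \<open>valid_pc\<close> give the same
  value on \<open>w\<close>. Undetermined status bits are chosen as in the concrete
  successor.\<close>

lemma ext_exec_approximates:
  fixes M :: "('r, 'm, 'd::{plus,one}, 's) machine"
  assumes machine: "valid_machine M p"
    and instr: "valid_instr M \<iota>"
    and acc: "access_known \<iota> v"
    and app: "approximates v w"
    and pc: "v (Inl (pc M)) \<noteq> None"
  shows "approximates (ext_exec M \<iota> (status M (sem \<iota> w (Inl (pc M)))) v) (sem \<iota> w)"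
    (is "approximates ?v' _")
proof -
  let ?P = "Inl (pc M) :: 'r + 'm"
  let ?c = "conc v"
  \<comment> \<open>Both \<open>w\<close> and \<open>conc v\<close> complete \<open>v\<close>, so
    operands, sources and targets can all be read off from \<open>v\<close>.\<close>
  have acc_w: "same_access \<iota> (regs v) (regs (lift w))"
    and acc_c: "same_access \<iota> (regs v) (regs (lift ?c))"
    using access_known_lift[OF acc] app approximates_conc by blast+
  have acc_cw: "same_access \<iota> (regs (lift ?c)) (regs (lift w))"
    using acc_w acc_c unfolding same_access_def by simp
  have operands_c: "operands \<iota> (regs (lift ?c)) = operands \<iota> (regs v)"
    and src_c: "src \<iota> (regs (lift ?c)) = src \<iota> (regs v)"
    and inputs_c: "inputs \<iota> (regs (lift ?c)) = inputs \<iota> (regs v)"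
    and targets_c: "targets \<iota> (regs (lift ?c)) = targets \<iota> (regs v)"
    and targets_w: "targets \<iota> (regs (lift w)) = targets \<iota> (regs v)"
    using acc_c acc_w
    unfolding same_access_def operands_def targets_def inputs_def fun_eq_iff by auto
  have agree: "v y \<noteq> None \<Longrightarrow> ?c y = w y" for y
    using approximates_agree[OF approximates_conc app] .
  have not_skip: "kind \<iota> \<noteq> Skip"
    and unchanged: "x \<notin> insert ?P (targets \<iota> (regs v)) \<Longrightarrow> sem \<iota> w x = w x" for x
    using instr targets_w unfolding valid_instr_def by metis+
  have pc_valid: "valid_pc M \<iota>"
    using instr unfolding valid_instr_def by blast
  have target: "sem \<iota> ?c x = sem \<iota> w x"
    if "x \<in> targets \<iota> (regs v)" "x \<noteq> ?P" "\<forall>y\<in>inputs \<iota> (regs v) x. v y \<noteq> None" for x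
    using instr acc_cw that agree unfolding valid_instr_def
    by (metis DiffI inputs_c singletonD targets_c)
  obtain d where d: "v ?P = Some d" "w ?P = d"
    using pc app approximates_SomeD by (metis not_None_eq)
  show ?thesis
    unfolding approximates_def
  proof (intro allI impI)
    fix x
    assume known: "?v' x \<noteq> None"
    show "?v' x = Some (sem \<iota> w x)"
    proof (cases "x = ?P")
      case False
      show ?thesis
      proof (cases "x \<in> targets \<iota> (regs v)")
        case True
        then have "?v' x = result M \<iota> v x"
          using False not_skip by (simp add: ext_exec_def)
        then show ?thesis
          using known target[OF True False] by (auto simp: result_def split: if_splits)
      next
        case outside: False
        then have "?v' x = v x"
          using False by (simp add: ext_exec_def)
        then show ?thesis
          using known app unchanged[of x] outside False unfolding approximates_def by simp
      qed
    next
      case True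
      consider (branch) "kind \<iota> = Branch" | (plain) "kind \<iota> \<noteq> Branch" "\<not> sets_status \<iota>"
        | (status) "kind \<iota> \<noteq> Branch" "sets_status \<iota>"
        by blast
      then show ?thesis
      proof cases
        case branch
        then have v': "?v' x = result M \<iota> v ?P"
          using True by (simp add: ext_exec_def)
        then have inputs: "\<forall>y\<in>src \<iota> (regs v) ?P. v y \<noteq> None" and res: "?v' x = Some (sem \<iota> ?c ?P)"
          using known branch by (auto simp: result_def inputs_def split: if_splits)
        \<comment> \<open>The old \<open>pc\<close> may influence the new one without being a
          declared source; it is known by assumption, so agreement extends to it.\<close>
        have "\<forall>y\<in>insert ?P (src \<iota> (regs (lift ?c)) ?P). ?c y = w y"
          using inputs pc agree src_c by auto
        then have "sem \<iota> ?c ?P = sem \<iota> w ?P"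
          using pc_valid branch acc_cw unfolding valid_pc_def Let_def by auto
        then show ?thesis using res True by simp
      next
        case plain
        then show ?thesis
          using True not_skip pc_valid d by (simp add: ext_exec_def valid_pc_def Let_def)
      next
        case status
        show ?thesis
        proof (cases "\<exists>y\<in>operands \<iota> (regs v). v y = None")
          case unknown: True
          have "\<exists>s. sem \<iota> w ?P = set_status M s (w ?P + 1)"
            using pc_valid status unfolding valid_pc_def Let_def by auto
          then obtain s where s: "sem \<iota> w ?P = set_status M s (w ?P + 1)" ..
          \<comment> \<open>Reading the status back recovers \<open>s\<close>, so the chosen status
            bits rebuild exactly the concrete \<open>pc\<close>.\<close>
          moreover have "status M (sem \<iota> w ?P) = s"
            using s machine unfolding valid_machine_def by simp
          ultimately show ?thesis
            using True unknown status not_skip d by (simp add: ext_exec_def)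
        next
          case False
          then have "\<forall>y\<in>insert ?P (operands \<iota> (regs (lift ?c))). ?c y = w y"
            using pc agree operands_c by auto
          then have "sem \<iota> ?c ?P = sem \<iota> w ?P"
            using pc_valid status acc_cw unfolding valid_pc_def Let_def by auto
          then show ?thesis
            using True False status not_skip by (auto simp: ext_exec_def Let_def)
        qed
      qed
    qed
  qed
qed

text \<open>Only a branch computes \<open>pc\<close> through \<open>result\<close>, which may yield
  \<open>None\<close>; branches are left to \<open>branches_known\<close>.\<close>

lemma ext_exec_pc_known:
  assumes "v (Inl (pc M)) \<noteq> None" "kind \<iota> \<noteq> Branch"
  shows "ext_exec M \<iota> s v (Inl (pc M)) \<noteq> None"
  using assms by (auto simp: ext_exec_def Let_def)

section \<open>The path of the extended tree that follows a concrete run\<close>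

primrec follow ::
  "('r, 'm, 'd::{plus,one}, 's) machine \<Rightarrow> ('g, 'r, 'm, 'd) program \<Rightarrow> ('r, 'm, 'd) state \<Rightarrow> nat
     \<Rightarrow> ('r, 'm, 'd) estate" where
  "follow M p w 0 = init_estate M"
| "follow M p w (Suc j) =
     ext_exec M (p ! pos M (follow M p w j))
       (status M (state_at M p w (Suc j) (Inl (pc M)))) (follow M p w j)"

definition follow_path ::
  "('r, 'm, 'd::{plus,one}, 's) machine \<Rightarrow> ('g, 'r, 'm, 'd) program \<Rightarrow> ('r, 'm, 'd) state \<Rightarrow> nat
     \<Rightarrow> ('r, 'm, 'd) estate list" where
  "follow_path M p w n = map (follow M p w) [0..<Suc n]"

lemma length_follow_path [simp]: "length (follow_path M p w n) = Suc n"
  by (simp add: follow_path_def)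

lemma nth_follow_path [simp]: "j \<le> n \<Longrightarrow> follow_path M p w n ! j = follow M p w j"
  by (simp add: follow_path_def del: upt_Suc)

text \<open>Each step of \<open>follow\<close> is \<open>ext_exec\<close> with some choice of status
  bits, hence an edge of the tree. So membership can be established before the last state is known
  to approximate the concrete one.\<close>

lemma follow_path_in_bot_paths:
  assumes "n \<le> K" "\<forall>j<n. points_into M p (follow M p w j)"
  shows "follow_path M p w n \<in> bot_paths M p K"
proof -
  have "follow_path M p w n \<noteq> []"
    by (simp add: follow_path_def)
  then show ?thesis
    using assms unfolding bot_paths_def ext_sem_def by auto
qed

lemma approximates_pos:
  assumes "approximates v w" "v (Inl (pc M)) \<noteq> None"
  shows "pos M v = pos M (lift w)" "points_into M p v \<longleftrightarrow> points_into M p (lift w)"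
  using assms unfolding approximates_def pos_def points_into_def lift_def by fastforce+

lemma access_known_bot_path:
  assumes "addresses_known M p K" "vs \<in> bot_paths M p K" "Suc j < length vs"
  shows "access_known (p ! pos M (vs ! j)) (vs ! j)"
  using assms unfolding addresses_known_def access_known_def by blast

text \<open>The three claims are proved together: a known \<open>pc\<close> transfers
  \<open>points_into\<close> from the concrete run, this puts the path into the tree, and only on
  paths of the tree do \<open>addresses_known\<close> and \<open>branches_known\<close> supply what
  the next step requires.\<close>

lemma follow_approximates:
  fixes M :: "('r, 'm, 'd::{plus,one}, 's) machine"
  assumes prog: "valid_program M p"
    and addresses: "addresses_known M p K"
    and branches: "branches_known M p K"
    and start: "w (Inl (pc M)) = entry M"
    and "n \<le> K" "\<forall>j<n. points_into M p (lift (state_at M p w j))"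
  shows "approximates (follow M p w n) (state_at M p w n) \<and> follow M p w n (Inl (pc M)) \<noteq> None
    \<and> (\<forall>j<n. points_into M p (follow M p w j))"
  using assms(5,6)
proof (induction n)
  case 0
  show ?case
    using start by (auto simp: approximates_def init_estate_def)
next
  case (Suc n)
  let ?v = "follow M p w n" and ?w = "state_at M p w n"
  let ?\<iota> = "p ! pos M ?v"
  let ?vs = "follow_path M p w (Suc n)"
  have app: "approximates ?v ?w" and pc: "?v (Inl (pc M)) \<noteq> None"
    and before: "\<forall>j<n. points_into M p (follow M p w j)"
    using Suc by auto
  have point: "points_into M p ?v"
    using approximates_pos(2)[OF app pc] Suc.prems by auto
  then have all: "\<forall>j<Suc n. points_into M p (follow M p w j)"
    using before less_Suc_eq by auto
  \<comment> \<open>The path is extended to \<open>Suc n\<close> first, because both hypotheses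
    speak only of states that have a successor on the path.\<close>
  then have path: "?vs \<in> bot_paths M p K"
    using Suc.prems follow_path_in_bot_paths by blast
  have nth: "?vs ! n = ?v" "?vs ! Suc n = follow M p w (Suc n)" "Suc n < length ?vs"
    by (simp_all del: follow.simps)
  have acc: "access_known ?\<iota> ?v"
    using access_known_bot_path[OF addresses path nth(3)] nth by simp
  have "pos M ?v < length p"
    using point unfolding points_into_def pos_def by auto
  then have valid: "valid_instr M ?\<iota>" and machine: "valid_machine M p"
    using prog unfolding valid_program_def by auto
  have next_state: "state_at M p w (Suc n) = sem ?\<iota> ?w"
    using approximates_pos(1)[OF app pc] by simp
  have "follow M p w (Suc n) = ext_exec M ?\<iota> (status M (sem ?\<iota> ?w (Inl (pc M)))) ?v"
    using next_state by simp
  then have "approximates (follow M p w (Suc n)) (state_at M p w (Suc n))"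
    using ext_exec_approximates[OF machine valid acc app pc] next_state by presburger
  moreover have "follow M p w (Suc n) (Inl (pc M)) \<noteq> None"
  proof (cases "kind ?\<iota> = Branch")
    case True
    then show ?thesis
      using branches path nth unfolding branches_known_def by metis
  next
    case False
    then show ?thesis
      using ext_exec_pc_known pc by simp
  qed
  ultimately show ?case
    using all by blast
qed

section \<open>Timing data under abstraction\<close>

lemma timing_of_abstraction:
  assumes alpha: "\<beta> = \<iota> \<or> \<beta> = abstracted M \<iota>"
    and "memR \<iota> (regs v) = memR \<iota> (regs v')" "memW \<iota> (regs v) = memW \<iota> (regs v')"
  shows "timing_of (\<iota>, v) = timing_of (\<beta>, v')"
  using assms by (auto simp: abstracted_def)

text \<open>For a critical instruction the addresses are functions of the registers on which the
  states agree; for any other, both address sets are empty under all register contents.\<close>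

lemma same_addresses_if_agree_when_critical:
  assumes valid: "valid_instr M \<iota>"
    and "critical \<iota> \<longrightarrow> (\<forall>r\<in>regR \<iota> \<union> regW \<iota>. v (Inl r) = v' (Inl r))"
  shows "memR \<iota> (regs v) = memR \<iota> (regs v') \<and> memW \<iota> (regs v) = memW \<iota> (regs v')"
proof (cases "critical \<iota>")
  case True
  then have "\<forall>r\<in>regR \<iota> \<union> regW \<iota>. regs v r = regs v' r"
    using assms(2) by (simp add: regs_def)
  then have "same_access \<iota> (regs v) (regs v')"
    using valid unfolding valid_instr_def by blast
  then show ?thesis
    by (simp add: same_access_def)
next
  case False
  then show ?thesis
    by (simp add: critical_def references_memory_def)
qed

text \<open>Termination bounds the \<open>LEAST\<close> in \<open>run_length\<close>; minimality
  makes all earlier states point into the program.\<close>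

lemma run_length_properties:
  assumes "terminates_within M p K w"
  shows "run_length M p w \<le> K"
    and "j < run_length M p w \<Longrightarrow> points_into M p (lift (state_at M p w j))"
proof -
  obtain n where "n \<le> K" "\<not> points_into M p (lift (state_at M p w n))"
    using assms unfolding terminates_within_def by blast
  then show "run_length M p w \<le> K"
    unfolding run_length_def by (metis (mono_tags, lifting) Least_le le_trans)
  show "points_into M p (lift (state_at M p w j))" if "j < run_length M p w"
    using that not_less_Least unfolding run_length_def by blast
qed

text \<open>The followed path mediates at every step: its addresses equal the concrete ones by
  \<open>addresses_known\<close> and the abstracted ones by \<open>abs_equiv\<close>.\<close>

lemma run_time_in_abs_runs:
  assumes prog: "valid_program M p"
    and start: "w (Inl (pc M)) = entry M"
    and ends: "terminates_within M p K w"
    and addresses: "addresses_known M p K"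
    and branches: "branches_known M p K"
    and alpha: "abstraction_mapping M p \<alpha>"
    and equiv: "abs_equiv M p K \<alpha>"
  shows "time H (run M p w) \<in> time H ` abs_runs M p K \<alpha>"
proof -
  define n where "n = run_length M p w"
  let ?vs = "follow_path M p w n"
  have "n \<le> K" and points: "\<And>j. j < n \<Longrightarrow> points_into M p (lift (state_at M p w j))"
    using run_length_properties[OF ends] unfolding n_def by blast+
  have follow: "approximates (follow M p w j) (state_at M p w j)"
    "follow M p w j (Inl (pc M)) \<noteq> None"
    "\<forall>i<j. points_into M p (follow M p w i)" if "j \<le> n" for j
    using follow_approximates[OF prog addresses branches, of w j] start points \<open>n \<le> K\<close> that
    by auto
  have path: "?vs \<in> bot_paths M p K"
    using follow_path_in_bot_paths[OF \<open>n \<le> K\<close>] follow(3) by blast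
  have step: "timing_of (p ! pos M (lift (state_at M p w j)), lift (state_at M p w j)) =
      timing_of (\<alpha> (pos M (?vs ! j)), abs_state M \<alpha> ?vs j)" if j: "j < n" for j
  proof -
    let ?v = "follow M p w j"
    let ?\<iota> = "p ! pos M ?v"
    have app: "approximates ?v (state_at M p w j)" and pc: "?v (Inl (pc M)) \<noteq> None"
      using follow j by simp_all
    have "points_into M p ?v"
      using follow(3)[of n] j by blast
    then have "pos M ?v < length p"
      unfolding points_into_def pos_def by auto
    then have valid: "valid_instr M ?\<iota>"
      and abs: "\<alpha> (pos M ?v) = ?\<iota> \<or> \<alpha> (pos M ?v) = abstracted M ?\<iota>"
      using prog alpha unfolding valid_program_def abstraction_mapping_def by auto
    have "access_known ?\<iota> ?v"
      using access_known_bot_path[OF addresses path, of j] j by simp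
    then have "same_access ?\<iota> (regs ?v) (regs (lift (state_at M p w j)))"
      using access_known_lift app by blast
    moreover have "critical ?\<iota> \<longrightarrow>
        (\<forall>r\<in>regR ?\<iota> \<union> regW ?\<iota>. ?v (Inl r) = abs_state M \<alpha> ?vs j (Inl r))"
      using equiv path j unfolding abs_equiv_def Let_def
      by (metis Suc_less_eq length_follow_path less_imp_le nth_follow_path)
    then have "memR ?\<iota> (regs ?v) = memR ?\<iota> (regs (abs_state M \<alpha> ?vs j)) \<and>
        memW ?\<iota> (regs ?v) = memW ?\<iota> (regs (abs_state M \<alpha> ?vs j))"
      using same_addresses_if_agree_when_critical[OF valid] by blast
    ultimately have "timing_of (?\<iota>, lift (state_at M p w j)) =
        timing_of (\<alpha> (pos M ?v), abs_state M \<alpha> ?vs j)"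
      using timing_of_abstraction[OF abs] unfolding same_access_def by metis
    then show ?thesis
      using approximates_pos(1)[OF app pc] j by simp
  qed
  \<comment> \<open>The path has \<open>n + 1\<close> states, so its abstracted run has
    \<open>n\<close> entries, as many as the concrete run. Keeping \<open>timing_of\<close> folded
    lets \<open>step\<close> apply entry by entry.\<close>
  have "map timing_of (run M p w) = map timing_of (abs_run M \<alpha> ?vs)"
    using step unfolding run_def abs_run_def n_def[symmetric]
    by (simp del: timing_of.simps)
  then have "time H (run M p w) = time H (abs_run M \<alpha> ?vs)"
    by (simp add: time_def)
  then show ?thesis
    using path unfolding abs_runs_def by blast
qed

section \<open>Finiteness of the tree and comparison of the maxima\<close>

lemma finite_bot_paths:
  fixes M :: "('r::finite, 'm::finite, 'd::{finite,plus,one}, 's) machine"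
  shows "finite (bot_paths M p K)"
proof (rule finite_subset)
  \<comment> \<open>There are finitely many extended states and the depth is bounded; the trivial
    bound \<open>UNIV\<close> fits the library fact on lists of bounded length.\<close>
  show "bot_paths M p K \<subseteq> {vs. set vs \<subseteq> UNIV \<and> length vs \<le> Suc K}"
    unfolding bot_paths_def by blast
  show "finite {vs :: ('r, 'm, 'd) estate list. set vs \<subseteq> UNIV \<and> length vs \<le> Suc K}"
    by (rule finite_lists_length_le) simp
qed

theorem lemma4:
  fixes M :: "('r::finite, 'm::finite, 'd::{finite,plus,one}, 's::finite) machine"
    and p :: "('g::finite, 'r, 'm, 'd) program"
    and H :: "('g, 'r, 'm) architecture"
    and V0 :: "('r, 'm, 'd) state set"
    and K :: nat
    and \<alpha> :: "nat \<Rightarrow> ('g, 'r, 'm, 'd) instr"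
  assumes "valid_program M p"
    and "V0 \<noteq> {}"
    and "\<forall>w\<in>V0. w (Inl (pc M)) = entry M"
    and "\<forall>w\<in>V0. terminates_within M p K w"
    and "addresses_known M p K"
    and "branches_known M p K"
    and "abstraction_mapping M p \<alpha>"
    and "abs_equiv M p K \<alpha>"
  shows "WCET M H p V0 \<le> abs_WCET M H p K \<alpha>"
proof -
  have finite: "finite (time H ` abs_runs M p K \<alpha>)"
    unfolding abs_runs_def by (simp add: finite_bot_paths)
  \<comment> \<open>Every concrete time occurs among the abstracted times, so it is at most their
    maximum.\<close>
  have "time H (run M p w) \<le> abs_WCET M H p K \<alpha>" if "w \<in> V0" for w
    unfolding abs_WCET_def using run_time_in_abs_runs assms that by (intro Max_ge[OF finite]) blast
  then show ?thesis
    unfolding WCET_def using \<open>V0 \<noteq> {}\<close> by simp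
qed

end
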